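(* Consider the split of bus $i$ into buses $i$ and $i'$, in which the lines $\{(i,j)\}_{j\in\mathcal{J}}$ are reconnected to $i'$ and an injection $\tilde p_i\in\mathbb{R}$ is moved from bus $i$ to bus $i'$. Let the pre-split dc power flow be $\boldsymbol{\theta}=\mathbf{B}^{-1}\mathbf{p}$, $\mathbf{f}=\mathbf{K}\boldsymbol{\theta}$, and let the post-split angle vector be $[\boldsymbol{\theta}';\tilde\theta_{i'}]=\tilde{\mathbf{B}}^{-1}\tilde{\mathbf{p}}\in\mathbb{R}^{N+1}$ with $\boldsymbol{\theta}'\in\mathbb{R}^N$. Then the phase angle difference at the original buses is $$\boldsymbol{\theta}'-\boldsymbol{\theta}=\boldsymbol{\Delta}_{\mathbf{u}}\boldsymbol{\theta}-(\mathbf{I}+\boldsymbol{\Delta}_{\mathbf{u}})\mathbf{B}^{-1}\left(\tilde p_i\mathbf{e}_i+d^{-1}\tilde p_i\boldsymbol{\ell}\right).$$ Accordingly, the difference between the post-split line flow $\tilde{\mathbf{f}}$ and the pre-split line flow $\mathbf{f}$ is $$\tilde{\mathbf{f}}-\mathbf{f}=\mathbf{K}\boldsymbol{\Delta}_{\mathbf{u}}\boldsymbol{\theta}-\mathbf{K}(\mathbf{I}+\boldsymbol{\Delta}_{\mathbf{u}})\mathbf{B}^{-1}\left(\tilde p_i\mathbf{e}_i+d^{-1}\tilde p_i\boldsymbol{\ell}\right),$$ where this equality is understood for the entries corresponding to all lines other than the reconnected ones $\{(i,j)\}_{j\in\mathcal{J}}$ (which become the lines $(i',j)$ after the split).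
   Context: Network. A transmission network has buses $\mathcal{N}=\{0,1,\dots,N\}$ and a set $\mathcal{L}$ of $L$ lines (unordered pairs of distinct buses, each listed with a fixed orientation $(k,m)$). The network is connected. Line $(k,m)$ has reactance $x_{km}=x_{mk}>0$ and $b_{km}=b_{mk}=1/x_{km}$. $\mathcal{N}_k$ is the set of buses adjacent to $k$. Bus $0$ is the reference, with angle $\theta_0=0$; $\boldsymbol{\theta}\in\mathbb{R}^N$ and $\mathbf{p}\in\mathbb{R}^N$ collect the angles and power injections of buses $1,\dots,N$. $\mathbf{e}_k\in\mathbb{R}^N$ is the $k$-th standard basis vector for $k\ge 1$, and $\mathbf{e}_0=\mathbf{0}$. The dc model: the flow on line $(k,m)$ is $f_{km}=b_{km}(\theta_k-\theta_m)$, i.e. $\mathbf{f}=\mathbf{K}\boldsymbol{\theta}$, where $\mathbf{K}\in\mathbb{R}^{L\times N}$ has row $b_{km}(\mathbf{e}_k-\mathbf{e}_m)^{\mathsf T}$ for line $(k,m)$. Moreover $\mathbf{p}=\mathbf{B}\boldsymbol{\theta}$ with the invertible matrix $\mathbf{B}=\sum_{(k,m)\in\mathcal{L}}b_{km}(\mathbf{e}_k-\mathbf{e}_m)(\mathbf{e}_k-\mathbf{e}_m)^{\mathsf T}\in\mathbb{R}^{N\times N}$. Bus split. Bus $i$ is split into $i$ and a new bus $i'$. A nonempty set $\mathcal{J}\subseteq\mathcal{N}_i$ collects the buses $j$ whose line $(i,j)$ is reconnected as $(i',j)$ with the same parameter $b_{ij}$; the other lines are unchanged. It is assumed that the split does not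 island the system: the post-split network, on $\mathcal{N}\cup\{i'\}$, is connected. Define $$\boldsymbol{\ell}=-\sum_{j\in\mathcal{J}}b_{ij}\mathbf{e}_j\in\mathbb{R}^N,\qquad d=\sum_{j\in\mathcal{J}}b_{ij},$$ $$\mathbf{B}'=\mathbf{B}-\sum_{j\in\mathcal{J}}b_{ij}\left[(\mathbf{e}_i-\mathbf{e}_j)(\mathbf{e}_i-\mathbf{e}_j)^{\mathsf T}-\mathbf{e}_j\mathbf{e}_j^{\mathsf T}\right],\qquad \tilde{\mathbf{B}}=\begin{bmatrix}\mathbf{B}'&\boldsymbol{\ell}\\ \boldsymbol{\ell}^{\mathsf T}&d\end{bmatrix}\in\mathbb{R}^{(N+1)\times(N+1)},$$ where the last coordinate corresponds to bus $i'$. The post-split injection vector is $\tilde{\mathbf{p}}=\begin{bmatrix}\mathbf{p}-\tilde p_i\mathbf{e}_i\\ \tilde p_i\end{bmatrix}$, where $\tilde p_i$ is the injection attached to bus $i'$ after the split. The post-split flow on a non-reconnected line $(k,m)$ is $\tilde f_{km}=b_{km}(\theta'_k-\theta'_m)$, with $\theta'_0=0$. Finally, $$\mathbf{u}=\mathbf{e}_i+d^{-1}\boldsymbol{\ell}\in\mathbb{R}^N,\qquad \boldsymbol{\Delta}_{\mathbf{u}}=\frac{d\,\mathbf{B}^{-1}\mathbf{u}\mathbf{u}^{\mathsf T}}{1-d\,\mathbf{u}^{\mathsf T}\mathbf{B}^{-1}\mathbf{u}}\in\mathbb{R}^{N\times N}.$$ *)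

theory Defs
  imports "HOL-Analysis.Analysis"
begin

text \<open>
  Buses are elements of \<open>'n option\<close>: \<open>None\<close> is the reference bus 0 and \<open>Some k\<close> are the
  buses 1, ..., N, so that N = CARD('n). The L = CARD('l) lines are indexed by \<open>'l\<close>, and
  \<open>line l = (k, m)\<close> gives the end buses of a line in its fixed orientation. After the split the
  buses are elements of \<open>'n option + unit\<close>, where \<open>Inr ()\<close> is the new bus \<open>i'\<close>; accordingly
  \<open>\<real>\<^sup>N\<^sup>+\<^sup>1\<close> is \<open>real ^ ('n + unit)\<close>, with last coordinate \<open>Inr ()\<close>.
\<close>

definition adjacent :: "('l \<Rightarrow> 'b \<times> 'b) \<Rightarrow> 'b \<Rightarrow> 'b \<Rightarrow> bool" where
  "adjacent line k m \<longleftrightarrow> (\<exists>l. line l = (k, m) \<or> line l = (m, k))"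

definition connected_network :: "('l \<Rightarrow> 'b \<times> 'b) \<Rightarrow> bool" where
  "connected_network line \<longleftrightarrow> (\<forall>k m. (adjacent line)\<^sup>*\<^sup>* k m)"

definition neighbours :: "('l \<Rightarrow> 'b \<times> 'b) \<Rightarrow> 'b \<Rightarrow> 'b set" where
  "neighbours line k = {m. adjacent line k m}"

definition reconnected :: "('l \<Rightarrow> 'b \<times> 'b) \<Rightarrow> 'b \<Rightarrow> 'b set \<Rightarrow> 'l \<Rightarrow> bool" where
  "reconnected line i J l \<longleftrightarrow> (\<exists>j\<in>J. line l = (i, j) \<or> line l = (j, i))"

definition split_line :: "('l \<Rightarrow> 'b \<times> 'b) \<Rightarrow> 'b \<Rightarrow> 'b set \<Rightarrow> 'l \<Rightarrow> ('b + unit) \<times> ('b + unit)" where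
  "split_line line i J l =
     (let end_bus = (\<lambda>k. if reconnected line i J l \<and> k = i then Inr () else Inl k)
      in (end_bus (fst (line l)), end_bus (snd (line l))))"

definition unit_vec :: "'n::finite option \<Rightarrow> real ^ 'n" where
  "unit_vec k = (case k of None \<Rightarrow> 0 | Some k' \<Rightarrow> axis k' 1)"

definition angle_at :: "real ^ 'n \<Rightarrow> 'n option \<Rightarrow> real" where
  "angle_at \<theta> k = (case k of None \<Rightarrow> 0 | Some k' \<Rightarrow> \<theta> $ k')"

definition outer :: "real ^ 'm \<Rightarrow> real ^ 'n \<Rightarrow> real ^ 'n ^ 'm" where
  "outer v w = (\<chi> r c. v $ r * w $ c)"

definition append_entry :: "real ^ 'n::finite \<Rightarrow> real \<Rightarrow> real ^ ('n + unit)" where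
  "append_entry v a = (\<chi> r. case r of Inl k \<Rightarrow> v $ k | Inr _ \<Rightarrow> a)"

definition bordered :: "real ^ 'n::finite ^ 'n \<Rightarrow> real ^ 'n \<Rightarrow> real \<Rightarrow> real ^ ('n + unit) ^ ('n + unit)" where
  "bordered A v a =
     (\<chi> r. case r of Inl k \<Rightarrow> append_entry (A $ k) (v $ k) | Inr _ \<Rightarrow> append_entry v a)"

definition K_mat ::
    "('l::finite \<Rightarrow> 'n::finite option \<times> 'n option) \<Rightarrow> ('n option \<Rightarrow> 'n option \<Rightarrow> real) \<Rightarrow> real ^ 'n ^ 'l" where
  "K_mat line b = (\<chi> l. case line l of (k, m) \<Rightarrow> b k m *\<^sub>R (unit_vec k - unit_vec m))"

definition B_mat ::
    "('l::finite \<Rightarrow> 'n::finite option \<times> 'n option) \<Rightarrow> ('n option \<Rightarrow> 'n option \<Rightarrow> real) \<Rightarrow> real ^ 'n ^ 'n" where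
  "B_mat line b = (\<Sum>l\<in>UNIV. case line l of (k, m) \<Rightarrow>
     b k m *\<^sub>R outer (unit_vec k - unit_vec m) (unit_vec k - unit_vec m))"

definition ell :: "('n::finite option \<Rightarrow> 'n option \<Rightarrow> real) \<Rightarrow> 'n option \<Rightarrow> 'n option set \<Rightarrow> real ^ 'n" where
  "ell b i J = - (\<Sum>j\<in>J. b i j *\<^sub>R unit_vec j)"

definition d_sum :: "('n option \<Rightarrow> 'n option \<Rightarrow> real) \<Rightarrow> 'n option \<Rightarrow> 'n option set \<Rightarrow> real" where
  "d_sum b i J = (\<Sum>j\<in>J. b i j)"

definition B'_mat ::
    "('l::finite \<Rightarrow> 'n::finite option \<times> 'n option) \<Rightarrow> ('n option \<Rightarrow> 'n option \<Rightarrow> real) \<Rightarrow>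
     'n option \<Rightarrow> 'n option set \<Rightarrow> real ^ 'n ^ 'n" where
  "B'_mat line b i J = B_mat line b -
     (\<Sum>j\<in>J. b i j *\<^sub>R (outer (unit_vec i - unit_vec j) (unit_vec i - unit_vec j)
                       - outer (unit_vec j) (unit_vec j)))"

definition Btilde_mat ::
    "('l::finite \<Rightarrow> 'n::finite option \<times> 'n option) \<Rightarrow> ('n option \<Rightarrow> 'n option \<Rightarrow> real) \<Rightarrow>
     'n option \<Rightarrow> 'n option set \<Rightarrow> real ^ ('n + unit) ^ ('n + unit)" where
  "Btilde_mat line b i J = bordered (B'_mat line b i J) (ell b i J) (d_sum b i J)"

definition u_vec :: "('n::finite option \<Rightarrow> 'n option \<Rightarrow> real) \<Rightarrow> 'n option \<Rightarrow> 'n option set \<Rightarrow> real ^ 'n" where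
  "u_vec b i J = unit_vec i + inverse (d_sum b i J) *\<^sub>R ell b i J"

definition Delta_u ::
    "('l::finite \<Rightarrow> 'n::finite option \<times> 'n option) \<Rightarrow> ('n option \<Rightarrow> 'n option \<Rightarrow> real) \<Rightarrow>
     'n option \<Rightarrow> 'n option set \<Rightarrow> real ^ 'n ^ 'n" where
  "Delta_u line b i J =
     (let Binv = matrix_inv (B_mat line b); u = u_vec b i J; d = d_sum b i J
      in (d *\<^sub>R (Binv ** outer u u)) /\<^sub>R (1 - d * (u \<bullet> (Binv *v u))))"

end

theory Submission
  imports Defs
begin

text \<open>
  The post-split system is \<open>N + 1\<close> equations in \<open>\<theta>'\<close> and the angle \<open>t\<close> of the new bus. Its last
  row, \<open>\<ell> \<bullet> \<theta>' + d t = p\<^sub>i\<close>, determines \<open>t\<close>, since \<open>d > 0\<close>. Eliminating \<open>t\<close> leaves the Schur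
  complement \<open>B' - d\<^sup>-\<^sup>1 \<ell> \<ell>\<^sup>T\<close> acting on \<open>\<theta>'\<close>, and completing the square shows that this matrix
  is a mere rank-one update of the original one, \<open>B - d u u\<^sup>T\<close>
  (\<open>schur_complement_rank_one_update\<close>). The right-hand side becomes \<open>p - p\<^sub>i u\<close>. So
  \<open>(B - d u u\<^sup>T) \<theta>' = p - p\<^sub>i u\<close>, and the Sherman-Morrison formula
  \<open>(B - d u u\<^sup>T)\<^sup>-\<^sup>1 = (I + \<Delta>\<^sub>u) B\<^sup>-\<^sup>1\<close> gives \<open>\<theta>' = (I + \<Delta>\<^sub>u) (\<theta> - B\<^sup>-\<^sup>1 p\<^sub>i u)\<close>, which is the claim
  about the angles. The claim about the flows follows by applying \<open>K\<close>.

  Three nondegeneracy facts are needed: \<open>B\<close> and \<open>B~\<close> are invertible, and the denominator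
  \<open>1 - d u\<^sup>T B\<^sup>-\<^sup>1 u\<close> does not vanish. The first two hold because the quadratic form of each matrix is
  the energy \<open>\<Sum> b\<^sub>k\<^sub>m (\<theta>\<^sub>k - \<theta>\<^sub>m)\<^sup>2\<close> of its network (\<open>B_mat_energy\<close>, \<open>Btilde_mat_energy\<close>): a vector in
  the kernel has zero energy, so the angles agree across every line, hence on the whole connected
  network, and they are \<open>0\<close> at the reference bus. The third fact follows from the second: if the
  denominator vanished, \<open>B\<^sup>-\<^sup>1 u\<close> would be annihilated by \<open>B - d u u\<^sup>T\<close>, and extending it by the
  eliminated coordinate would produce a nonzero vector in the kernel of \<open>B~\<close>.
\<close>

section \<open>Matrix and vector identities\<close>

lemma unit_vec_inner: "unit_vec k \<bullet> y = angle_at y k"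
  by (cases k) (simp_all add: unit_vec_def angle_at_def inner_axis')

lemma outer_mult_vec: "outer v w *v y = (w \<bullet> y) *\<^sub>R v"
  by (simp add: vec_eq_iff outer_def matrix_vector_mult_def inner_vec_def
      sum_distrib_left sum_distrib_right mult_ac)

lemma sum_mult_vec: "(\<Sum>s\<in>S. A s) *v y = (\<Sum>s\<in>S. A s *v y)"
  for A :: "'a \<Rightarrow> real ^ 'n ^ 'm"
  by (induction S rule: infinite_finite_induct) (simp_all add: matrix_vector_mult_add_rdistrib)

lemma append_entry_inner: "append_entry v a \<bullet> append_entry w c = v \<bullet> w + a * c"
proof -
  have "append_entry v a \<bullet> append_entry w c
      = (\<Sum>r\<in>(UNIV :: 'a set) <+> (UNIV :: unit set). append_entry v a $ r * append_entry w c $ r)"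
    by (simp add: inner_vec_def)
  also have "\<dots> = v \<bullet> w + a * c"
    by (subst sum.Plus) (simp_all add: inner_vec_def append_entry_def UNIV_unit)
  finally show ?thesis .
qed

lemma append_entry_eq_iff: "append_entry v a = append_entry w c \<longleftrightarrow> v = w \<and> a = c"
  by (auto simp: append_entry_def vec_eq_iff split_sum_all)

lemma append_entry_eq_0_iff: "append_entry v a = 0 \<longleftrightarrow> v = 0 \<and> a = 0"
  by (auto simp: append_entry_def vec_eq_iff split_sum_all)

lemma append_entry_exhaust:
  obtains v a where "z = append_entry v a"
proof
  show "z = append_entry (\<chi> k. z $ Inl k) (z $ Inr ())"
    by (auto simp: append_entry_def vec_eq_iff split_sum_all split: sum.split)
qed

lemma bordered_mult_vec:
  "bordered A v a *v append_entry y t = append_entry (A *v y + t *\<^sub>R v) (v \<bullet> y + a * t)"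
proof -
  have "(bordered A v a *v append_entry y t) $ r
      = append_entry (A *v y + t *\<^sub>R v) (v \<bullet> y + a * t) $ r" for r
    unfolding matrix_vector_mul_component
    by (cases r) (simp_all add: bordered_def append_entry_inner append_entry_def[of "A *v y + _"]
        matrix_vector_mul_component)
  then show ?thesis
    by (simp add: vec_eq_iff)
qed

text \<open>
  \<^const>\<open>matrix_inv\<close> is a choice that is meaningful only for invertible matrices; for a square
  matrix a trivial kernel suffices.
\<close>

lemma inverse_mult_vec_cancel:
  fixes A :: "real ^ 'n ^ 'n"
  assumes ker: "\<And>y. A *v y = 0 \<Longrightarrow> y = 0"
  shows "A *v (matrix_inv A *v y) = y" and "matrix_inv A *v (A *v y) = y"
proof -
  have "\<exists>A'. A ** A' = mat 1 \<and> A' ** A = mat 1"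
    using ker by (metis matrix_left_invertible_ker matrix_left_right_inverse)
  then have "A ** matrix_inv A = mat 1 \<and> matrix_inv A ** A = mat 1"
    unfolding matrix_inv_def by (rule someI_ex)
  then show "A *v (matrix_inv A *v y) = y" and "matrix_inv A *v (A *v y) = y"
    by (simp_all add: matrix_vector_mul_assoc)
qed

section \<open>The dc matrices and their energies\<close>

text \<open>
  Every term of the energy is nonnegative, so zero energy makes \<open>\<phi>\<close> equal at the two ends of each
  line, and this propagates along paths. The bus type is arbitrary because the lemma serves both
  the original and the split network.
\<close>

lemma constant_if_zero_energy:
  fixes net :: "'l::finite \<Rightarrow> 'b \<times> 'b" and \<phi> :: "'b \<Rightarrow> real"
  assumes conn: "connected_network net" and pos: "\<And>l. w l > 0"
    and zero: "(\<Sum>l\<in>UNIV. w l * (\<phi> (fst (net l)) - \<phi> (snd (net l)))\<^sup>2) = 0"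
  shows "\<phi> k = \<phi> m"
proof -
  have ends: "\<phi> (fst (net l)) = \<phi> (snd (net l))" for l
  proof -
    have "w l * (\<phi> (fst (net l)) - \<phi> (snd (net l)))\<^sup>2 = 0"
      using zero by (subst (asm) sum_nonneg_eq_0_iff)
        (auto intro!: mult_nonneg_nonneg simp: less_imp_le[OF pos])
    then show ?thesis using pos[of l] by simp
  qed
  have "(adjacent net)\<^sup>*\<^sup>* k m"
    using conn by (simp add: connected_network_def)
  then show ?thesis
  proof induction
    case (step m n)
    then obtain l where "net l = (m, n) \<or> net l = (n, m)"
      by (auto simp: adjacent_def)
    then have "\<phi> m = \<phi> n"
      using ends[of l] by auto
    then show ?case using step.IH by simp
  qed simp
qed

lemma K_mat_mult_vec:
  assumes "line l = (k, m)"
  shows "(K_mat line b *v y) $ l = b k m * (angle_at y k - angle_at y m)"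
  using assms
  by (simp add: matrix_vector_mul_component K_mat_def inner_diff_left unit_vec_inner)

lemma B_mat_energy:
  "y \<bullet> (B_mat line b *v y) =
   (\<Sum>l\<in>UNIV. b (fst (line l)) (snd (line l)) *
     (angle_at y (fst (line l)) - angle_at y (snd (line l)))\<^sup>2)"
  unfolding B_mat_def sum_mult_vec inner_sum_right
  by (intro sum.cong refl)
    (simp add: case_prod_unfold scaleR_matrix_vector_assoc[symmetric] outer_mult_vec
      inner_diff_left inner_commute[of y] unit_vec_inner power2_eq_square)

text \<open>
  The energy only forces the angles to be constant; the constant is \<open>0\<close> because the reference bus
  has angle \<open>0\<close>.
\<close>

lemma B_mat_kernel:
  assumes "connected_network line" and "\<And>l. b (fst (line l)) (snd (line l)) > 0"
    and "B_mat line b *v y = 0"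
  shows "y = 0"
proof -
  have "angle_at y k = angle_at y None" for k
    using assms(3) B_mat_energy[of y line b]
    by (intro constant_if_zero_energy[where \<phi> = "angle_at y"
          and w = "\<lambda>l. b (fst (line l)) (snd (line l))", OF assms(1,2)]) simp
  from this[of "Some k" for k] show ?thesis
    by (simp add: angle_at_def vec_eq_iff)
qed

lemma B'_mat_mult_vec:
  "B'_mat line b i J *v y = B_mat line b *v y -
     (\<Sum>j\<in>J. b i j *\<^sub>R ((angle_at y i - angle_at y j) *\<^sub>R (unit_vec i - unit_vec j)
                       - angle_at y j *\<^sub>R unit_vec j))"
  by (simp add: B'_mat_def matrix_vector_mult_diff_rdistrib sum_mult_vec
      scaleR_matrix_vector_assoc[symmetric] outer_mult_vec inner_diff_left unit_vec_inner)

lemma ell_inner: "ell b i J \<bullet> y = - (\<Sum>j\<in>J. b i j * angle_at y j)"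
  by (simp add: ell_def inner_sum_left unit_vec_inner)

section \<open>The split network\<close>

text \<open>
  The matrices describe the split by sums over the buses in \<open>J\<close>, the split network by a change of
  lines. This lemma translates between the two: sending a reconnected line to its end other than
  \<open>i\<close> is a bijection onto \<open>J\<close>, injective for want of parallel lines and surjective because \<open>J\<close>
  consists of neighbours of \<open>i\<close>.
\<close>

lemma sum_reconnected:
  fixes line :: "'l::finite \<Rightarrow> 'b \<times> 'b" and h :: "'b \<Rightarrow> 'c::comm_monoid_add"
  assumes distinct_ends: "\<And>l. fst (line l) \<noteq> snd (line l)"
    and no_parallel: "inj (\<lambda>l. {fst (line l), snd (line l)})"
    and J: "J \<subseteq> neighbours line i"
  defines "far \<equiv> \<lambda>l. if fst (line l) = i then snd (line l) else fst (line l)"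
  shows "(\<Sum>l | reconnected line i J l. h (far l)) = sum h J"
proof (rule sum.reindex_bij_betw)
  have far: "far l \<in> J \<and> {fst (line l), snd (line l)} = {i, far l}"
    if R: "reconnected line i J l" for l
  proof -
    obtain j where "j \<in> J" and j: "line l = (i, j) \<or> line l = (j, i)"
      using R unfolding reconnected_def by blast
    moreover have "j \<noteq> i"
      using j distinct_ends[of l] by auto
    moreover have "far l = j"
      using j \<open>j \<noteq> i\<close> unfolding far_def by (metis fst_conv snd_conv)
    moreover have "{fst (line l), snd (line l)} = {i, j}"
      using j by (metis fst_conv snd_conv insert_commute)
    ultimately show ?thesis by simp
  qed
  have "inj_on far {l. reconnected line i J l}"
  proof (rule inj_onI)
    fix l l'
    assume "l \<in> {l. reconnected line i J l}" "l' \<in> {l. reconnected line i J l}" "far l = far l'"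
    then have "{fst (line l), snd (line l)} = {fst (line l'), snd (line l')}"
      using far by simp
    then show "l = l'"
      by (rule injD[OF no_parallel])
  qed
  moreover have "far ` {l. reconnected line i J l} = J"
  proof
    show "far ` {l. reconnected line i J l} \<subseteq> J" using far by auto
    show "J \<subseteq> far ` {l. reconnected line i J l}"
    proof
      fix j assume "j \<in> J"
      then obtain l where l: "line l = (i, j) \<or> line l = (j, i)"
        using J by (auto simp: neighbours_def adjacent_def)
      then have "j \<noteq> i"
        using distinct_ends[of l] by auto
      then have "far l = j"
        using l unfolding far_def by (metis fst_conv snd_conv)
      moreover have "reconnected line i J l"
        using l \<open>j \<in> J\<close> unfolding reconnected_def by blast
      ultimately show "j \<in> far ` {l. reconnected line i J l}" by auto
    qed
  qed
  ultimately show "bij_betw far {l. reconnected line i J l} J"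
    by (simp add: bij_betw_def)
qed

text \<open>
  The split changes the energy only on the reconnected lines, where \<open>b\<^sub>i\<^sub>j (y\<^sub>i - y\<^sub>j)\<^sup>2\<close> becomes
  \<open>b\<^sub>i\<^sub>j (t - y\<^sub>j)\<^sup>2\<close>. In the matrix, \<open>B'\<close> removes the former term and adds \<open>b\<^sub>i\<^sub>j y\<^sub>j\<^sup>2\<close>, while the border
  supplies \<open>- 2 b\<^sub>i\<^sub>j t y\<^sub>j + b\<^sub>i\<^sub>j t\<^sup>2\<close>. Symmetry of \<open>b\<close> covers the lines at \<open>i\<close> that are
  listed as \<open>(j, i)\<close>.
\<close>

lemma Btilde_mat_energy:
  fixes line :: "'l::finite \<Rightarrow> 'n::finite option \<times> 'n option"
  assumes distinct_ends: "\<And>l. fst (line l) \<noteq> snd (line l)"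
    and no_parallel: "inj (\<lambda>l. {fst (line l), snd (line l)})"
    and J: "J \<subseteq> neighbours line i"
    and sym: "\<And>k m. adjacent line k m \<Longrightarrow> b k m = b m k"
  shows "append_entry y t \<bullet> (Btilde_mat line b i J *v append_entry y t) =
    (\<Sum>l\<in>UNIV. b (fst (line l)) (snd (line l)) *
      (case_sum (angle_at y) (\<lambda>_. t) (fst (split_line line i J l))
       - case_sum (angle_at y) (\<lambda>_. t) (snd (split_line line i J l)))\<^sup>2)"
proof -
  let ?R = "{l. reconnected line i J l}"
  define before where "before l = b (fst (line l)) (snd (line l)) *
      (angle_at y (fst (line l)) - angle_at y (snd (line l)))\<^sup>2" for l
  define after where "after l = b (fst (line l)) (snd (line l)) *
      (case_sum (angle_at y) (\<lambda>_. t) (fst (split_line line i J l))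
       - case_sum (angle_at y) (\<lambda>_. t) (snd (split_line line i J l)))\<^sup>2" for l
  define change where "change j = b i j * ((angle_at y j - t)\<^sup>2 - (angle_at y i - angle_at y j)\<^sup>2)" for j
  have change_line: "after l - before l =
      change (if fst (line l) = i then snd (line l) else fst (line l))"
    if R: "reconnected line i J l" for l
  proof -
    obtain j where j: "line l = (i, j) \<or> line l = (j, i)"
      using R by (auto simp: reconnected_def)
    have ij: "i \<noteq> j" using j distinct_ends[of l] by auto
    have b: "b j i = b i j"
      using sym[of i j] j unfolding adjacent_def by metis
    from j show ?thesis
    proof
      assume "line l = (i, j)"
      then show ?thesis
        using R ij by (simp add: after_def before_def change_def split_line_def
            power2_eq_square algebra_simps)
    next
      assume "line l = (j, i)"
      then show ?thesis
        using R ij by (simp add: after_def before_def change_def split_line_def b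
            power2_eq_square algebra_simps)
    qed
  qed
  have same_line: "after l - before l = 0" if "\<not> reconnected line i J l" for l
    using that by (simp add: after_def before_def split_line_def Let_def)
  have "sum after UNIV - sum before UNIV = (\<Sum>l\<in>UNIV. after l - before l)"
    by (simp add: sum_subtractf)
  also have "\<dots> = (\<Sum>l\<in>?R. after l - before l)"
    using same_line by (intro sum.mono_neutral_right) auto
  also have "\<dots> = (\<Sum>l\<in>?R. change (if fst (line l) = i then snd (line l) else fst (line l)))"
    by (intro sum.cong refl change_line) simp
  also have "\<dots> = sum change J"
    by (rule sum_reconnected[OF distinct_ends no_parallel J])
  finally have net: "sum after UNIV = sum before UNIV + sum change J" by simp
  have "append_entry y t \<bullet> (Btilde_mat line b i J *v append_entry y t) =
      y \<bullet> (B_mat line b *v y)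
      - (\<Sum>j\<in>J. b i j * ((angle_at y i - angle_at y j)\<^sup>2 - (angle_at y j)\<^sup>2))
      - 2 * t * (\<Sum>j\<in>J. b i j * angle_at y j) + (\<Sum>j\<in>J. b i j) * t\<^sup>2"
    by (simp add: Btilde_mat_def bordered_mult_vec append_entry_inner B'_mat_mult_vec
        inner_add_right inner_diff_right inner_sum_right inner_commute[of y] inner_diff_left
        unit_vec_inner ell_inner d_sum_def power2_eq_square algebra_simps)
  also have "\<dots> = sum before UNIV + sum change J"
    by (simp add: B_mat_energy before_def change_def sum_distrib_left sum_distrib_right
        power2_eq_square algebra_simps sum.distrib sum_subtractf sum_negf)
  also have "\<dots> = sum after UNIV"
    by (rule net[symmetric])
  finally show ?thesis
    unfolding after_def .
qed

lemma Btilde_mat_kernel: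
  fixes line :: "'l::finite \<Rightarrow> 'n::finite option \<times> 'n option"
  assumes distinct_ends: "\<And>l. fst (line l) \<noteq> snd (line l)"
    and no_parallel: "inj (\<lambda>l. {fst (line l), snd (line l)})"
    and J: "J \<subseteq> neighbours line i"
    and sym: "\<And>k m. adjacent line k m \<Longrightarrow> b k m = b m k"
    and pos: "\<And>l. b (fst (line l)) (snd (line l)) > 0"
    and conn: "connected_network (split_line line i J)"
    and zero: "Btilde_mat line b i J *v z = 0"
  shows "z = 0"
proof -
  obtain y t where z: "z = append_entry y t" by (rule append_entry_exhaust)
  define \<phi> :: "'n option + unit \<Rightarrow> real" where "\<phi> = case_sum (angle_at y) (\<lambda>_. t)"
  have "(\<Sum>l\<in>UNIV. b (fst (line l)) (snd (line l)) *
      (\<phi> (fst (split_line line i J l)) - \<phi> (snd (split_line line i J l)))\<^sup>2) = 0"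
    using Btilde_mat_energy[where b = b and y = y and t = t, OF distinct_ends no_parallel J sym] zero
    by (simp add: z \<phi>_def)
  then have const: "\<phi> k = \<phi> (Inl None)" for k
    by (rule constant_if_zero_energy[where w = "\<lambda>l. b (fst (line l)) (snd (line l))", OF conn pos])
  have "y = 0"
    using const[of "Inl (Some k)" for k] by (simp add: \<phi>_def angle_at_def vec_eq_iff)
  moreover have "t = 0"
    using const[of "Inr ()"] by (simp add: \<phi>_def angle_at_def)
  ultimately show ?thesis by (simp add: z append_entry_eq_0_iff)
qed

section \<open>Eliminating the new bus\<close>

text \<open>
  Expanding its sum gives \<open>B' = B - d e\<^sub>i e\<^sub>i\<^sup>T - e\<^sub>i \<ell>\<^sup>T - \<ell> e\<^sub>i\<^sup>T\<close>: the terms \<open>e\<^sub>j e\<^sub>j\<^sup>T\<close> cancel. Subtracting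
  \<open>d\<^sup>-\<^sup>1 \<ell> \<ell>\<^sup>T\<close>, which eliminating the last coordinate does, completes the square to
  \<open>d (e\<^sub>i + d\<^sup>-\<^sup>1 \<ell>) (e\<^sub>i + d\<^sup>-\<^sup>1 \<ell>)\<^sup>T\<close>.
\<close>

lemma schur_complement_rank_one_update:
  assumes "d_sum b i J \<noteq> 0"
  shows "B'_mat line b i J *v y - (inverse (d_sum b i J) * (ell b i J \<bullet> y)) *\<^sub>R ell b i J =
    B_mat line b *v y - (d_sum b i J * (u_vec b i J \<bullet> y)) *\<^sub>R u_vec b i J"
proof -
  let ?d = "d_sum b i J" and ?l = "ell b i J" and ?e = "unit_vec i :: real ^ 'a"
  have "B'_mat line b i J *v y = B_mat line b *v y -
    (\<Sum>j\<in>J. (b i j * angle_at y i) *\<^sub>R ?e - angle_at y i *\<^sub>R (b i j *\<^sub>R unit_vec j)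
            - (b i j * angle_at y j) *\<^sub>R ?e)"
    unfolding B'_mat_mult_vec
    by (intro arg_cong2[where f = minus] refl sum.cong) (simp add: algebra_simps)
  also have "\<dots> = B_mat line b *v y -
      ((?d * angle_at y i) *\<^sub>R ?e + angle_at y i *\<^sub>R ?l + (?l \<bullet> y) *\<^sub>R ?e)"
    unfolding ell_inner
    by (simp add: sum_subtractf ell_def d_sum_def scaleR_sum_left[symmetric]
        sum_distrib_left scaleR_sum_right mult.commute)
  finally have B': "B'_mat line b i J *v y = \<dots>" .
  have "?d * (u_vec b i J \<bullet> y) = ?d * angle_at y i + ?l \<bullet> y"
    using assms by (simp add: u_vec_def inner_add_left unit_vec_inner field_simps)
  moreover have "(?d * angle_at y i + ?l \<bullet> y) * inverse ?d = angle_at y i + inverse ?d * (?l \<bullet> y)"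
    using assms by (simp add: field_simps)
  ultimately have "(?d * (u_vec b i J \<bullet> y)) *\<^sub>R u_vec b i J =
      (?d * angle_at y i + ?l \<bullet> y) *\<^sub>R ?e + (angle_at y i + inverse ?d * (?l \<bullet> y)) *\<^sub>R ?l"
    by (simp only: u_vec_def scaleR_add_right scaleR_scaleR)
  then show ?thesis
    unfolding B' by (simp add: scaleR_add_left)
qed


theorem proposition1:
  fixes line :: "'l::finite \<Rightarrow> 'n::finite option \<times> 'n option"
    and x b :: "'n option \<Rightarrow> 'n option \<Rightarrow> real"
    and i :: "'n option" and J :: "'n option set"
    and p \<theta> \<theta>' :: "real ^ 'n" and p\<^sub>i \<theta>\<^sub>i' :: real
    and f f' :: "real ^ 'l"
  assumes distinct_ends: "\<And>l. fst (line l) \<noteq> snd (line l)"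
    and no_parallel: "inj (\<lambda>l. {fst (line l), snd (line l)})"
    and connected: "connected_network line"
    and reactance: "\<And>k m. adjacent line k m \<Longrightarrow> x k m = x m k \<and> x k m > 0"
    and susceptance: "\<And>k m. adjacent line k m \<Longrightarrow> b k m = 1 / x k m"
    and J: "J \<noteq> {}" "J \<subseteq> neighbours line i"
    and not_islanded: "connected_network (split_line line i J)"
    and pre_angles: "\<theta> = matrix_inv (B_mat line b) *v p"
    and pre_flow: "f = K_mat line b *v \<theta>"
    and post_angles: "append_entry \<theta>' \<theta>\<^sub>i' =
      matrix_inv (Btilde_mat line b i J) *v append_entry (p - p\<^sub>i *\<^sub>R unit_vec i) p\<^sub>i"
    and post_flow: "\<And>l k m. line l = (k, m) \<Longrightarrow> \<not> reconnected line i J l \<Longrightarrow>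
      f' $ l = b k m * (angle_at \<theta>' k - angle_at \<theta>' m)"
  shows "\<theta>' - \<theta> = Delta_u line b i J *v \<theta>
           - (mat 1 + Delta_u line b i J) ** matrix_inv (B_mat line b)
               *v (p\<^sub>i *\<^sub>R unit_vec i + (inverse (d_sum b i J) * p\<^sub>i) *\<^sub>R ell b i J)
       \<and> (\<forall>l. \<not> reconnected line i J l \<longrightarrow>
           (f' - f) $ l =
             (K_mat line b ** Delta_u line b i J *v \<theta>
               - K_mat line b ** (mat 1 + Delta_u line b i J) ** matrix_inv (B_mat line b)
                   *v (p\<^sub>i *\<^sub>R unit_vec i + (inverse (d_sum b i J) * p\<^sub>i) *\<^sub>R ell b i J)) $ l)"
proof -
  let ?B = "B_mat line b" and ?Bt = "Btilde_mat line b i J"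
  let ?d = "d_sum b i J" and ?l = "ell b i J" and ?u = "u_vec b i J" and ?D = "Delta_u line b i J"
  have sym: "b k m = b m k" and pos_adj: "b k m > 0" if "adjacent line k m" for k m
  proof -
    have "adjacent line m k" using that by (auto simp: adjacent_def)
    then show "b k m = b m k" and "b k m > 0"
      using that reactance[of k m] susceptance[of k m] susceptance[of m k] by simp_all
  qed
  have pos: "b (fst (line l)) (snd (line l)) > 0" for l
    by (rule pos_adj) (auto simp: adjacent_def intro!: exI[of _ l])
  have "?d > 0"
    unfolding d_sum_def using J by (intro sum_pos pos_adj) (auto simp: neighbours_def)
  note B_inv = inverse_mult_vec_cancel[of ?B, OF B_mat_kernel[where b = b, OF connected pos]]
  note Bt_kernel = Btilde_mat_kernel[where b = b, OF distinct_ends no_parallel J(2) sym pos not_islanded]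
  note update = schur_complement_rank_one_update[of b i J line, OF less_imp_neq[OF \<open>?d > 0\<close>, symmetric]]
  define z where "z = matrix_inv ?B *v ?u"
  have Bz: "?B *v z = ?u" by (simp add: z_def B_inv)
  define q where "q = matrix_inv ?B *v (p - p\<^sub>i *\<^sub>R ?u)"
  define \<delta> where "\<delta> = 1 - ?d * (?u \<bullet> z)"

  \<comment> \<open>Otherwise \<open>z\<close>, extended by the angle that the last row of the post-split system with zero
    injections prescribes, is a kernel vector of that system.\<close>
  have "\<delta> \<noteq> 0"
  proof
    assume "\<delta> = 0"
    then have uz: "?d * (?u \<bullet> z) = 1" by (simp add: \<delta>_def)
    have "B'_mat line b i J *v z - (inverse ?d * (?l \<bullet> z)) *\<^sub>R ?l = 0"
      unfolding update by (simp add: uz Bz)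
    then have "?Bt *v append_entry z (- inverse ?d * (?l \<bullet> z)) = 0"
      using \<open>?d > 0\<close> by (simp add: Btilde_mat_def bordered_mult_vec append_entry_eq_0_iff)
    then have "z = 0"
      using Bt_kernel append_entry_eq_0_iff by blast
    then show False using uz by simp
  qed

  have "?Bt *v append_entry \<theta>' \<theta>\<^sub>i' = append_entry (p - p\<^sub>i *\<^sub>R unit_vec i) p\<^sub>i"
    unfolding post_angles by (rule inverse_mult_vec_cancel[OF Bt_kernel])
  then have top: "B'_mat line b i J *v \<theta>' + \<theta>\<^sub>i' *\<^sub>R ?l = p - p\<^sub>i *\<^sub>R unit_vec i"
    and bottom: "?l \<bullet> \<theta>' + ?d * \<theta>\<^sub>i' = p\<^sub>i"
    by (simp_all add: Btilde_mat_def bordered_mult_vec append_entry_eq_iff)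
  have t: "\<theta>\<^sub>i' = inverse ?d * p\<^sub>i - inverse ?d * (?l \<bullet> \<theta>')"
    using bottom \<open>?d > 0\<close> by (auto simp: field_simps)
  have "B'_mat line b i J *v \<theta>' - (inverse ?d * (?l \<bullet> \<theta>')) *\<^sub>R ?l = p - p\<^sub>i *\<^sub>R ?u"
    using top unfolding t by (simp add: u_vec_def algebra_simps)
  then have "?B *v \<theta>' = (p - p\<^sub>i *\<^sub>R ?u) + (?d * (?u \<bullet> \<theta>')) *\<^sub>R ?u"
    unfolding update by (simp add: algebra_simps)
  then have "matrix_inv ?B *v (?B *v \<theta>') = q + (?d * (?u \<bullet> \<theta>')) *\<^sub>R z"
    by (simp add: q_def z_def matrix_vector_right_distrib matrix_vector_mult_scaleR)
  then have \<theta>': "\<theta>' = q + (?d * (?u \<bullet> \<theta>')) *\<^sub>R z"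
    by (simp add: B_inv)
  \<comment> \<open>The unknown is now only the scalar \<open>u \<bullet> \<theta>'\<close>; taking the inner product with \<open>u\<close> gives one
    linear equation for it, with coefficient \<open>\<delta>\<close>.\<close>
  have "?u \<bullet> \<theta>' = ?u \<bullet> q + ?d * (?u \<bullet> \<theta>') * (?u \<bullet> z)"
    by (subst \<theta>') (simp add: inner_add_right)
  then have "?u \<bullet> \<theta>' = (?u \<bullet> q) / \<delta>"
    using \<open>\<delta> \<noteq> 0\<close> by (simp add: \<delta>_def field_simps)
  moreover have Delta: "?D *v v = (?d * (?u \<bullet> v) / \<delta>) *\<^sub>R z" for v
    by (simp add: Delta_u_def Let_def scaleR_matrix_vector_assoc[symmetric]
        matrix_vector_mul_assoc[symmetric] outer_mult_vec matrix_vector_mult_scaleR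
        z_def[symmetric] \<delta>_def[symmetric] divide_inverse mult_ac)
  ultimately have "\<theta>' = q + ?D *v q"
    using \<theta>' by simp
  moreover have "q = \<theta> - matrix_inv ?B *v (p\<^sub>i *\<^sub>R ?u)"
    by (simp add: q_def pre_angles matrix_vector_mult_diff_distrib)
  moreover have "p\<^sub>i *\<^sub>R ?u = p\<^sub>i *\<^sub>R unit_vec i + (inverse ?d * p\<^sub>i) *\<^sub>R ?l"
    by (simp add: u_vec_def algebra_simps)
  ultimately have angles: "\<theta>' - \<theta> = ?D *v \<theta> - (mat 1 + ?D) ** matrix_inv ?B
      *v (p\<^sub>i *\<^sub>R unit_vec i + (inverse ?d * p\<^sub>i) *\<^sub>R ?l)"
    by (simp add: matrix_vector_mul_assoc[symmetric] matrix_vector_mult_add_rdistrib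
        matrix_vector_mult_diff_distrib)
  moreover have "(f' - f) $ l = (K_mat line b ** ?D *v \<theta>
      - K_mat line b ** (mat 1 + ?D) ** matrix_inv ?B
          *v (p\<^sub>i *\<^sub>R unit_vec i + (inverse ?d * p\<^sub>i) *\<^sub>R ?l)) $ l"
    if "\<not> reconnected line i J l" for l
  proof -
    obtain k m where l: "line l = (k, m)" by fastforce
    have "(f' - f) $ l = (K_mat line b *v (\<theta>' - \<theta>)) $ l"
      by (simp add: post_flow[OF l that] pre_flow K_mat_mult_vec[of line l, OF l]
          matrix_vector_mult_diff_distrib)
    then show ?thesis
      unfolding angles
      by (simp add: matrix_vector_mult_diff_distrib matrix_vector_mul_assoc matrix_mul_assoc)
  qed
  ultimately show ?thesis by blast
qed

end
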